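(* Let $G$ be a finite abelian group of order $N$, let $S\subseteq G\setminus\{0\}$ satisfy $S=-S$, and let $K$ be a field with $\operatorname{char}(K)\nmid N$. Then the number of idempotents of the algebra $\mathcal{A}_K(\mathrm{Cay}(G,S))$ is $2^r$, where $r=|\mathcal{O}_K(G,S)|$.
   Context: $G$ is written additively. $\mathrm{Cay}(G,S)$ is the graph with vertex set $G$ and edges $\{g,g+s\}$ for $g\in G$, $s\in S$. Its adjacency matrix $A$, with rows and columns indexed by $G$, has $A_{g,h}=1$ if $h-g\in S$ and $A_{g,h}=0$ otherwise; it is regarded as a matrix over $K$. The spectral algebra is $\mathcal{A}_K(\mathrm{Cay}(G,S))=K[A]=\{f(A):f\in K[x]\}\subseteq M_N(K)$. $\overline{K}$ is an algebraic closure of $K$, $\widehat{G}=\mathrm{Hom}(G,\overline{K}^* )$, and $\lambda_\chi=\sum_{s\in S}\chi(s)\in\overline{K}$ for $\chi\in\widehat{G}$. $\mathcal{O}_K(G,S)$ is the partition of the set $\{\lambda_\chi:\chi\in\widehat{G}\}$ into orbits of $\mathrm{Gal}(\overline{K}/K)$ (the group of $K$-automorphisms of $\overline{K}$). *)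

theory Defs
  imports
    "HOL-Analysis.Cartesian_Space"
    "HOL-Algebra.Algebraic_Closure_Type"
begin

text \<open>The types \<open>((_, 'g) vec, 'g) vec\<close> below are \<open>_ ^ 'g ^ 'g\<close>, spelled out because \<open>^\<close> forces the
  sort of a type variable on its right to be \<open>finite\<close>.\<close>

definition cayley_adjacency :: "'g::{finite, ab_group_add} set \<Rightarrow> (('k::field, 'g) vec, 'g) vec" where
  "cayley_adjacency S = (\<chi> g h. if h - g \<in> S then 1 else 0)"

text \<open>The product \<open>*\<close> on the type of square matrices is the entrywise one, so powers (and hence
  the evaluation of a polynomial at a matrix) are introduced for the matrix product \<open>**\<close>.\<close>

primrec matrix_pow :: "'k::semiring_1 ^ 'n ^ 'n \<Rightarrow> nat \<Rightarrow> 'k ^ 'n ^ 'n" where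
  "matrix_pow A 0 = mat 1"
| "matrix_pow A (Suc m) = A ** matrix_pow A m"

definition poly_matrix :: "'k::comm_semiring_1 poly \<Rightarrow> 'k ^ 'n ^ 'n \<Rightarrow> 'k ^ 'n ^ 'n" where
  "poly_matrix f A = (\<chi> i j. \<Sum>m\<le>degree f. coeff f m * matrix_pow A m $ i $ j)"

definition cayley_spectral_algebra :: "'g::{finite, ab_group_add} set \<Rightarrow> (('k::field, 'g) vec, 'g) vec set" where
  "cayley_spectral_algebra S = {poly_matrix f (cayley_adjacency S) | f. True}"

definition characters :: "('g::ab_group_add \<Rightarrow> 'l::field) set" where
  "characters = {\<psi>. (\<forall>g. \<psi> g \<noteq> 0) \<and> (\<forall>g h. \<psi> (g + h) = \<psi> g * \<psi> h)}"

definition char_eigenvalue :: "'g set \<Rightarrow> ('g \<Rightarrow> 'l::field) \<Rightarrow> 'l" where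
  "char_eigenvalue S \<psi> = (\<Sum>s\<in>S. \<psi> s)"

definition galois_group :: "('k::field alg_closure \<Rightarrow> 'k alg_closure) set" where
  "galois_group = {\<sigma>. bij \<sigma> \<and> (\<forall>x y. \<sigma> (x + y) = \<sigma> x + \<sigma> y) \<and>
     (\<forall>x y. \<sigma> (x * y) = \<sigma> x * \<sigma> y) \<and> (\<forall>c. \<sigma> (to_ac c) = to_ac c)}"

definition galois_orbit :: "'k::field alg_closure \<Rightarrow> 'k alg_closure set" where
  "galois_orbit x = {\<sigma> x | \<sigma>. \<sigma> \<in> galois_group}"

text \<open>The field \<open>K\<close> does not occur in the argument \<open>S\<close>; it is determined by the result type.\<close>

definition eigenvalue_orbits :: "'g::{finite, ab_group_add} set \<Rightarrow> 'k::field alg_closure set set" where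
  "eigenvalue_orbits S = galois_orbit ` char_eigenvalue S ` characters"

end

theory Submission
  imports Defs
begin

text \<open>Every \<open>f(A)\<close> is circulant, and its Fourier transform at a character \<open>\<psi>\<close> is \<open>f(\<lambda>\<^sub>\<psi>)\<close>. As the
  characters separate functions on \<open>G\<close>, the matrix \<open>f(A)\<close> is determined by the values of \<open>f\<close> at the
  eigenvalues, and it is idempotent iff these values lie in \<open>{0, 1}\<close>. They are then constant on Galois
  orbits. Conversely, eigenvalues in different orbits are separated by a polynomial over \<open>K\<close>, since a
  \<open>K\<close>-isomorphism between two simple extensions extends to the algebraic closure (Zorn); so the
  indicator function of any set of orbits is given by a polynomial over \<open>K\<close>. No separability of the
  eigenvalues is needed.\<close>

text \<open>Otherwise \<open>$\<close> on vectors would be ambiguous with the coefficient of a power series.\<close>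

no_notation fps_nth (infixl \<open>$\<close> 75)

section \<open>Extending partial automorphisms of the algebraic closure\<close>

definition eval_ac :: "'k::field poly \<Rightarrow> 'k alg_closure \<Rightarrow> 'k alg_closure" where
  "eval_ac f x = poly (map_poly to_ac f) x"

lemma eval_ac_0 [simp]: "eval_ac 0 x = 0"
  by (simp add: eval_ac_def)

lemma eval_ac_pCons [simp]: "eval_ac (pCons a p) x = to_ac a + x * eval_ac p x"
  by (simp add: eval_ac_def map_poly_pCons)

lemma eval_ac_1 [simp]: "eval_ac 1 x = 1"
  by (simp add: one_pCons)

lemma eval_ac_add [simp]: "eval_ac (p + q) x = eval_ac p x + eval_ac q x"
  by (induction p q rule: poly_induct2) (auto simp: algebra_simps)

lemma eval_ac_smult [simp]: "eval_ac (smult c p) x = to_ac c * eval_ac p x"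
  by (induction p) (auto simp: algebra_simps)

lemma eval_ac_mult [simp]: "eval_ac (p * q) x = eval_ac p x * eval_ac q x"
  by (induction p) (auto simp: algebra_simps)

lemma eval_ac_diff [simp]: "eval_ac (p - q) x = eval_ac p x - eval_ac q x"
  by (metis add_diff_cancel diff_add_cancel eval_ac_add)

lemma eval_ac_minus [simp]: "eval_ac (- p) x = - eval_ac p x"
  using eval_ac_diff[of 0 p x] by simp

lemma eval_ac_sum: "eval_ac (\<Sum>i\<in>I. f i) x = (\<Sum>i\<in>I. eval_ac (f i) x)"
  by (induction I rule: infinite_finite_induct) auto

lemma eval_ac_prod: "eval_ac (\<Prod>i\<in>I. f i) x = (\<Prod>i\<in>I. eval_ac (f i) x)"
  by (induction I rule: infinite_finite_induct) auto

lemma eval_ac_pcompose [simp]: "eval_ac (pcompose p q) x = eval_ac p (eval_ac q x)"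
  by (induction p) (auto simp: pcompose_pCons)

lemma eval_ac_altdef: "eval_ac f x = (\<Sum>i\<le>degree f. to_ac (coeff f i) * x ^ i)"
  by (simp add: eval_ac_def poly_altdef coeff_map_poly degree_map_poly)

lemma eval_ac_galois:
  assumes "\<sigma> \<in> galois_group"
  shows "\<sigma> (eval_ac p x) = eval_ac p (\<sigma> x)"
proof (induction p)
  case 0
  from assms have "\<sigma> (to_ac 0) = to_ac 0"
    unfolding galois_group_def by blast
  then show ?case by simp
next
  case (pCons a p)
  with assms show ?case by (simp add: galois_group_def)
qed

text \<open>Removing factors \<open>X\<close> from an annihilating polynomial makes its constant
  term \<open>a\<close> non-zero. Then \<open>a + x * p(x) = 0\<close> exhibits
  \<open>- p(x) / a\<close> as the inverse of \<open>x\<close>, so \<open>K[x]\<close> is a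
  field.\<close>

lemma inverse_eval_ac:
  assumes "x \<noteq> 0"
  obtains k where "x * eval_ac k x = 1"
proof -
  have "\<exists>k. x * eval_ac k x = 1" if "p \<noteq> 0" "eval_ac p x = 0" for p
    using that
  proof (induction p)
    case (pCons a p)
    show ?case
    proof (cases "a = 0")
      case True
      with pCons assms show ?thesis by auto
    next
      case False
      have "x * eval_ac (smult (-1 / a) p) x = - (x * eval_ac p x) / to_ac a"
        by simp
      also from pCons.prems have "- (x * eval_ac p x) = to_ac a"
        by (simp add: neg_eq_iff_add_eq_0 add.commute)
      finally have "x * eval_ac (smult (-1 / a) p) x = 1"
        using False by simp
      then show ?thesis by blast
    qed
  qed auto
  moreover obtain p where "p \<noteq> 0" "eval_ac p x = 0"
    using alg_closure_algebraic unfolding eval_ac_def by metis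
  ultimately show ?thesis using that by blast
qed

text \<open>The graph of a \<open>K\<close>-algebra homomorphism defined on a subalgebra of the algebraic
  closure \<open>L\<close>, as a single-valued subalgebra of \<open>L \<times> L\<close>. It is automatically injective, because
  \<open>L\<close> is algebraic over \<open>K\<close>.\<close>

definition partial_hom :: "('k::field alg_closure \<times> 'k alg_closure) set \<Rightarrow> bool" where
  "partial_hom R \<longleftrightarrow> (\<forall>c. (to_ac c, to_ac c) \<in> R) \<and>
     (\<forall>x y x' y'. (x, y) \<in> R \<longrightarrow> (x', y') \<in> R \<longrightarrow> (x + x', y + y') \<in> R \<and> (x * x', y * y') \<in> R) \<and>
     (\<forall>y. (0, y) \<in> R \<longrightarrow> y = 0)"

lemma partial_hom_to_ac: "partial_hom R \<Longrightarrow> (to_ac c, to_ac c) \<in> R"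
  and partial_hom_add: "partial_hom R \<Longrightarrow> (x, y) \<in> R \<Longrightarrow> (x', y') \<in> R \<Longrightarrow> (x + x', y + y') \<in> R"
  and partial_hom_mult: "partial_hom R \<Longrightarrow> (x, y) \<in> R \<Longrightarrow> (x', y') \<in> R \<Longrightarrow> (x * x', y * y') \<in> R"
  and partial_hom_0D: "partial_hom R \<Longrightarrow> (0, y) \<in> R \<Longrightarrow> y = 0"
  unfolding partial_hom_def by blast+

lemma partial_hom_0: "partial_hom R \<Longrightarrow> (0, 0) \<in> R"
  using partial_hom_to_ac[of R 0] by simp

lemma partial_hom_uminus: "partial_hom R \<Longrightarrow> (x, y) \<in> R \<Longrightarrow> (- x, - y) \<in> R"
  using partial_hom_mult[OF _ partial_hom_to_ac[of R "-1"], of x y] by simp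

lemma partial_hom_diff: "partial_hom R \<Longrightarrow> (x, y) \<in> R \<Longrightarrow> (x', y') \<in> R \<Longrightarrow> (x - x', y - y') \<in> R"
  using partial_hom_add[of R x y "- x'" "- y'"] partial_hom_uminus[of R x' y'] by simp

lemma partial_hom_unique: "partial_hom R \<Longrightarrow> (x, y) \<in> R \<Longrightarrow> (x, y') \<in> R \<Longrightarrow> y = y'"
  using partial_hom_diff[of R x y x y'] partial_hom_0D[of R "y - y'"] by simp

lemma partial_hom_eval_ac: "partial_hom R \<Longrightarrow> (x, y) \<in> R \<Longrightarrow> (eval_ac p x, eval_ac p y) \<in> R"
  by (induction p) (auto intro: partial_hom_0 partial_hom_add partial_hom_mult partial_hom_to_ac)

text \<open>Injectivity: the inverse of \<open>x \<noteq> 0\<close> is a polynomial in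
  \<open>x\<close>, so if \<open>x\<close> were sent to \<open>0\<close>, then
  \<open>1 = x * k(x)\<close> would be sent to both \<open>0\<close> and \<open>1\<close>.\<close>

lemma partial_hom_eq_0:
  assumes "partial_hom R" "(x, 0) \<in> R"
  shows "x = 0"
proof (rule ccontr)
  assume "x \<noteq> 0"
  then obtain k where k: "x * eval_ac k x = 1"
    by (rule inverse_eval_ac)
  have "(x * eval_ac k x, 0 * eval_ac k 0) \<in> R"
    by (intro partial_hom_mult partial_hom_eval_ac assms)
  then have "(1, 0) \<in> R" by (simp add: k)
  moreover have "(1, 1) \<in> R"
    using partial_hom_to_ac[OF assms(1), of 1] by simp
  ultimately show False
    using partial_hom_unique[OF assms(1), of 1 0 1] by simp
qed

text \<open>The polynomial \<open>g\<close> arises from \<open>f\<close> by applying the map with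
  graph \<open>R\<close> to the coefficients; the relational form suits a map that is only
  partial.\<close>

definition paired :: "('a::zero \<times> 'b::zero) set \<Rightarrow> 'a poly \<Rightarrow> 'b poly \<Rightarrow> bool" where
  "paired R f g \<longleftrightarrow> (\<forall>i. (coeff f i, coeff g i) \<in> R)"

lemma paired_add: "partial_hom R \<Longrightarrow> paired R f g \<Longrightarrow> paired R f' g' \<Longrightarrow> paired R (f + f') (g + g')"
  by (simp add: paired_def partial_hom_add)

lemma paired_diff: "partial_hom R \<Longrightarrow> paired R f g \<Longrightarrow> paired R f' g' \<Longrightarrow> paired R (f - f') (g - g')"
  by (simp add: paired_def partial_hom_diff)

lemma paired_mult:
  assumes "partial_hom R" "paired R f g" "paired R f' g'"
  shows "paired R (f * f') (g * g')"
proof -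
  have sum: "(\<Sum>i\<in>I. u i, \<Sum>i\<in>I. v i) \<in> R" if "\<And>i. (u i, v i) \<in> R"
    for I :: "nat set" and u v
    using that assms(1)
    by (induction I rule: infinite_finite_induct) (auto intro: partial_hom_add partial_hom_0)
  show ?thesis
    using assms unfolding paired_def coeff_mult by (intro allI sum) (auto intro: partial_hom_mult)
qed

lemma paired_monom: "partial_hom R \<Longrightarrow> (x, y) \<in> R \<Longrightarrow> paired R (monom x n) (monom y n)"
  by (simp add: paired_def partial_hom_0)

text \<open>Single-valuedness and injectivity of \<open>R\<close> make corresponding coefficients
  vanish together.\<close>

lemma paired_degree:
  assumes "partial_hom R" "paired R f g"
  shows "degree g = degree f" and "g = 0 \<longleftrightarrow> f = 0"
proof -
  have *: "coeff f i = 0 \<longleftrightarrow> coeff g i = 0" for i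
    using assms partial_hom_0D partial_hom_eq_0 unfolding paired_def by metis
  show "g = 0 \<longleftrightarrow> f = 0"
    using * by (auto simp: poly_eq_iff)
  show "degree g = degree f"
    using * by (simp add: degree_def)
qed

text \<open>Here \<open>p\<close> is a relation of least degree for \<open>a\<close> over the domain
  of \<open>R\<close>, and \<open>b\<close> is a root of its image \<open>q\<close>. The new graph
  consists of the pairs \<open>(f(a), g(b))\<close> with \<open>f\<close> and \<open>g\<close>
  paired; it is single-valued because \<open>f(a) = 0\<close> forces
  \<open>g(b) = 0\<close>.\<close>

lemma partial_hom_extend:
  assumes R: "partial_hom R"
  obtains R' b where "R \<subseteq> R'" "partial_hom R'" "(a, b) \<in> R'"
proof -
  obtain p0 where p0: "p0 \<noteq> 0" "poly (map_poly to_ac p0) a = 0"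
    by (rule alg_closure_algebraic)
  define P where "P = (\<lambda>(p, q). p \<noteq> 0 \<and> poly p a = 0 \<and> paired R p q)"
  have "P (map_poly to_ac p0, map_poly to_ac p0)"
    using p0 R by (auto simp: P_def paired_def coeff_map_poly map_poly_eq_0_iff partial_hom_to_ac)
  from ex_has_least_nat[of P, OF this, of "\<lambda>(p, q). degree p"]
  obtain p q where pq: "p \<noteq> 0" "poly p a = 0" "paired R p q"
    and least: "\<And>f g. f \<noteq> 0 \<Longrightarrow> poly f a = 0 \<Longrightarrow> paired R f g \<Longrightarrow> degree p \<le> degree f"
    unfolding P_def by force
  note deg = paired_degree[OF R pq(3)]
  have "degree p > 0"
  proof (rule ccontr)
    assume "\<not> degree p > 0"
    then obtain c where "p = [:c:]" by (auto elim: degree_eq_zeroE)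
    with pq show False by simp
  qed
  with deg alg_closed_imp_poly_has_root[of q] obtain b where b: "poly q b = 0" by auto
  have zero: "poly g b = 0" if "paired R f g" "poly f a = 0" for f g
    using that
  proof (induction "degree f" arbitrary: f g rule: less_induct)
    case less
    note deg' = paired_degree[OF R less.prems(1)]
    show ?case
    proof (cases "f = 0")
      case True
      with deg' show ?thesis by simp
    next
      case False
      with least less.prems have le: "degree p \<le> degree f" by blast
      \<comment> \<open>One step of division by \<open>p\<close>, cross-multiplied by the leading
        coefficients: the leading terms cancel using ring operations only, under which
        \<open>R\<close> is closed by definition.\<close>
      let ?n = "degree f - degree p"
      let ?f1 = "monom (lead_coeff p) 0 * f" and ?f2 = "monom (lead_coeff f) ?n * p"
      let ?g1 = "monom (lead_coeff q) 0 * g" and ?g2 = "monom (lead_coeff g) ?n * q"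
      have lc: "(lead_coeff p, lead_coeff q) \<in> R" "(lead_coeff f, lead_coeff g) \<in> R"
        using pq less.prems deg deg' by (auto simp: paired_def)
      have pair: "paired R (?f1 - ?f2) (?g1 - ?g2)"
        by (intro paired_diff paired_mult paired_monom R lc pq less.prems)
      have d1: "degree ?f1 = degree f" "degree ?f2 = degree f"
        using pq(1) False le by (simp_all add: degree_mult_eq degree_monom_eq)
      have c: "coeff (?f1 - ?f2) (degree f) = 0"
        using le by (simp add: coeff_monom_mult)
      have "?f1 - ?f2 = 0 \<or> degree (?f1 - ?f2) < degree f"
        using d1 c by (metis degree_diff_le order.refl le_neq_implies_less leading_coeff_0_iff)
      moreover have "poly (?f1 - ?f2) a = 0"
        using pq less.prems by simp
      ultimately have "poly (?g1 - ?g2) b = 0"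
        using less.hyps pair paired_degree(2)[OF R pair] by (metis poly_0)
      moreover have "lead_coeff q \<noteq> 0"
        using deg(2) pq(1) leading_coeff_0_iff by blast
      \<comment> \<open>The second product vanishes at \<open>b\<close> together with
        \<open>q\<close>, which leaves \<open>lead_coeff q * g(b) = 0\<close>.\<close>
      ultimately show ?thesis
        using b by (simp add: poly_monom)
    qed
  qed
  define R' where "R' = {(poly f a, poly g b) | f g. paired R f g}"
  have "R \<subseteq> R'"
  proof safe
    fix x y assume "(x, y) \<in> R"
    then have "paired R (monom x 0) (monom y 0)" by (intro paired_monom R)
    then show "(x, y) \<in> R'" unfolding R'_def by (auto simp: poly_monom intro!: exI)
  qed
  moreover have "(a, b) \<in> R'"
  proof -
    have "paired R (monom (to_ac 1) 1) (monom (to_ac 1) 1)"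
      by (intro paired_monom R partial_hom_to_ac)
    then show ?thesis
      unfolding R'_def
      by (intro CollectI exI[of _ "monom 1 1"]) (auto simp: poly_monom)
  qed
  moreover have "partial_hom R'"
    unfolding partial_hom_def
  proof (intro conjI allI impI)
    show "(to_ac c, to_ac c) \<in> R'" for c
      using partial_hom_to_ac[OF R] \<open>R \<subseteq> R'\<close> by blast
    show "y = 0" if "(0, y) \<in> R'" for y
    proof -
      from that obtain f g where "paired R f g" "poly f a = 0" "y = poly g b"
        by (auto simp: R'_def)
      then show ?thesis using zero by simp
    qed
    fix x y x' y' assume "(x, y) \<in> R'" "(x', y') \<in> R'"
    then obtain f g f' g' where *: "paired R f g" "paired R f' g'"
      "x = poly f a" "y = poly g b" "x' = poly f' a" "y' = poly g' b"
      unfolding R'_def by blast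
    show "(x + x', y + y') \<in> R'" unfolding R'_def
      using paired_add[OF R *(1,2)] *(3-6)
      by (intro CollectI exI[of _ "f + f'"] exI[of _ "g + g'"]) simp
    show "(x * x', y * y') \<in> R'" unfolding R'_def
      using paired_mult[OF R *(1,2)] *(3-6)
      by (intro CollectI exI[of _ "f * f'"] exI[of _ "g * g'"]) simp
  qed
  ultimately show ?thesis using that by blast
qed

text \<open>Zorn's lemma gives a maximal extension, which is total since any element can be
  adjoined. It is injective, and hence surjective on the finite root set of each polynomial over
  \<open>K\<close>.\<close>

lemma partial_hom_extends_to_galois:
  assumes R0: "partial_hom R0"
  obtains \<sigma> where "\<sigma> \<in> galois_group" "\<And>x y. (x, y) \<in> R0 \<Longrightarrow> \<sigma> x = y"
proof -
  define A where "A = {R. partial_hom R \<and> R0 \<subseteq> R}"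
  have "\<exists>M\<in>A. \<forall>R\<in>A. M \<subseteq> R \<longrightarrow> R = M"
  proof (rule subset_Zorn_nonempty)
    show "A \<noteq> {}" using R0 by (auto simp: A_def)
    fix C assume C: "C \<noteq> {}" "subset.chain A C"
    then have CA: "\<And>R. R \<in> C \<Longrightarrow> partial_hom R \<and> R0 \<subseteq> R"
      by (auto simp: A_def subset.chain_def)
    \<comment> \<open>Two pairs from the union lie in a common member of the chain, so the closure
      properties pass to the union.\<close>
    have two: "\<exists>R\<in>C. u \<in> R \<and> v \<in> R" if "u \<in> \<Union>C" "v \<in> \<Union>C" for u v
    proof -
      from that obtain R1 R2 where "R1 \<in> C" "R2 \<in> C" "u \<in> R1" "v \<in> R2" by blast
      moreover from this C have "R1 \<subseteq> R2 \<or> R2 \<subseteq> R1"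
        by (auto simp: subset.chain_def)
      ultimately show ?thesis by blast
    qed
    have "partial_hom (\<Union>C)"
      unfolding partial_hom_def
    proof (intro conjI allI impI)
      show "(to_ac c, to_ac c) \<in> \<Union>C" for c
        using C(1) CA partial_hom_to_ac by blast
      show "y = 0" if "(0, y) \<in> \<Union>C" for y
        using that CA partial_hom_0D by blast
      show "(x + x', y + y') \<in> \<Union>C" if "(x, y) \<in> \<Union>C" "(x', y') \<in> \<Union>C" for x y x' y'
        using two[OF that] CA partial_hom_add by blast
      show "(x * x', y * y') \<in> \<Union>C" if "(x, y) \<in> \<Union>C" "(x', y') \<in> \<Union>C" for x y x' y'
        using two[OF that] CA partial_hom_mult by blast
    qed
    moreover have "R0 \<subseteq> \<Union>C" using C(1) CA by blast
    ultimately show "\<Union>C \<in> A" by (simp add: A_def)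
  qed
  then obtain M where "M \<in> A" and max: "\<And>R. R \<in> A \<Longrightarrow> M \<subseteq> R \<Longrightarrow> R = M"
    by auto
  then have M: "partial_hom M" "R0 \<subseteq> M"
    by (simp_all add: A_def)
  have "\<exists>y. (x, y) \<in> M" for x
  proof -
    obtain R y where R: "M \<subseteq> R" "partial_hom R" "(x, y) \<in> R"
      by (rule partial_hom_extend[OF M(1)])
    with M(2) have "R \<in> A" by (simp add: A_def)
    with R max show ?thesis by blast
  qed
  then obtain \<sigma> where \<sigma>: "\<And>x. (x, \<sigma> x) \<in> M" by metis
  have eq: "\<sigma> x = y" if "(x, y) \<in> M" for x y
    using partial_hom_unique[OF M(1) \<sigma> that] .
  have add: "\<sigma> (x + y) = \<sigma> x + \<sigma> y" for x y
    by (intro eq partial_hom_add M \<sigma>)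
  have inj: "inj \<sigma>"
  proof (rule injI)
    fix x y assume "\<sigma> x = \<sigma> y"
    then have "(x - y, 0) \<in> M"
      using partial_hom_diff[OF M(1) \<sigma>[of x] \<sigma>[of y]] by simp
    then have "x - y = 0" by (rule partial_hom_eq_0[OF M(1)])
    then show "x = y" by simp
  qed
  have "surj \<sigma>"
  proof -
    have "b \<in> range \<sigma>" for b
    proof -
      obtain p where p: "p \<noteq> 0" "poly (map_poly to_ac p) b = 0"
        by (rule alg_closure_algebraic)
      let ?Z = "{x. poly (map_poly to_ac p) x = 0}"
      have "finite ?Z"
        using p(1) by (intro poly_roots_finite) (simp add: map_poly_eq_0_iff)
      moreover have "\<sigma> ` ?Z \<subseteq> ?Z"
      proof safe
        fix x assume "poly (map_poly to_ac p) x = 0"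
        then have "(0, eval_ac p (\<sigma> x)) \<in> M"
          using partial_hom_eval_ac[OF M(1) \<sigma>[of x], of p] by (simp add: eval_ac_def)
        then show "poly (map_poly to_ac p) (\<sigma> x) = 0"
          using partial_hom_0D[OF M(1)] by (simp add: eval_ac_def)
      qed
      ultimately have "\<sigma> ` ?Z = ?Z"
        using inj by (intro endo_inj_surj) (auto intro: inj_on_subset)
      with p show ?thesis by blast
    qed
    then show ?thesis by blast
  qed
  with inj have "bij \<sigma>" by (simp add: bij_def)
  then have "\<sigma> \<in> galois_group"
    unfolding galois_group_def
    by (auto intro!: eq partial_hom_mult partial_hom_to_ac M \<sigma> simp: add)
  with that eq M(2) show ?thesis by blast
qed

section \<open>Galois orbits and their separation by polynomials over \<open>K\<close>\<close>

text \<open>An automorphism over \<open>K\<close> preserves polynomial relations. Conversely,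
  inclusion of the relations makes \<open>f(x) \<mapsto> f(y)\<close> a well-defined homomorphism on
  \<open>K[x]\<close>, which extends to an automorphism.\<close>

lemma mem_galois_orbit_iff:
  "y \<in> galois_orbit x \<longleftrightarrow> (\<forall>f. eval_ac f x = 0 \<longrightarrow> eval_ac f y = 0)"
proof
  assume "y \<in> galois_orbit x"
  then obtain \<sigma> where "\<sigma> \<in> galois_group" "y = \<sigma> x"
    by (auto simp: galois_orbit_def)
  then show "\<forall>f. eval_ac f x = 0 \<longrightarrow> eval_ac f y = 0"
    by (metis eval_ac_0 eval_ac_galois)
next
  assume *: "\<forall>f. eval_ac f x = 0 \<longrightarrow> eval_ac f y = 0"
  define R where "R = (\<lambda>f. (eval_ac f x, eval_ac f y)) ` UNIV"
  have R: "(eval_ac f x, eval_ac f y) \<in> R" for f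
    by (simp add: R_def)
  have "partial_hom R"
    unfolding partial_hom_def
  proof (intro conjI allI impI)
    show "(to_ac c, to_ac c) \<in> R" for c
      using R[of "[:c:]"] by simp
    show "z = 0" if "(0, z) \<in> R" for z
      using that * by (auto simp: R_def)
    fix u v u' v' assume "(u, v) \<in> R" "(u', v') \<in> R"
    then obtain f g where "u = eval_ac f x" "v = eval_ac f y" "u' = eval_ac g x" "v' = eval_ac g y"
      by (auto simp: R_def)
    then show "(u + u', v + v') \<in> R" "(u * u', v * v') \<in> R"
      using R[of "f + g"] R[of "f * g"] by simp_all
  qed
  then obtain \<sigma> where "\<sigma> \<in> galois_group" "\<And>u v. (u, v) \<in> R \<Longrightarrow> \<sigma> u = v"
    by (rule partial_hom_extends_to_galois) blast
  then show "y \<in> galois_orbit x"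
    using R[of "[:0, 1:]"] by (auto simp: galois_orbit_def)
qed

text \<open>Injectivity of the automorphism taking \<open>x\<close> to \<open>y\<close> gives both
  elements the same polynomial relations, and these determine the orbit.\<close>

lemma galois_orbit_eq_iff: "galois_orbit y = galois_orbit x \<longleftrightarrow> y \<in> galois_orbit x"
proof
  assume "galois_orbit y = galois_orbit x"
  moreover have "y \<in> galois_orbit y" by (simp add: mem_galois_orbit_iff)
  ultimately show "y \<in> galois_orbit x" by simp
next
  assume y: "y \<in> galois_orbit x"
  then obtain \<sigma> where \<sigma>: "\<sigma> \<in> galois_group" "y = \<sigma> x"
    by (auto simp: galois_orbit_def)
  have inj: "inj \<sigma>" and "\<sigma> (to_ac 0) = to_ac 0"
    using \<sigma>(1) unfolding galois_group_def bij_def by blast+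
  then have "\<sigma> z = 0 \<longleftrightarrow> z = 0" for z
    by (metis injD to_ac_0)
  then have "eval_ac f y = 0 \<longleftrightarrow> eval_ac f x = 0" for f
    using eval_ac_galois[OF \<sigma>(1)] \<sigma>(2) by metis
  then show "galois_orbit y = galois_orbit x"
    by (auto simp: mem_galois_orbit_iff)
qed

text \<open>A product of polynomials that vanish at the points of the other orbits but not at
  \<open>\<mu>\<close> is normalised to the value \<open>1\<close> at \<open>\<mu>\<close>. This
  value spreads over the orbit because zero sets of polynomials over \<open>K\<close> are stable
  under conjugation.\<close>

lemma orbit_indicator_polynomial:
  assumes "finite \<Lambda>" "\<mu> \<in> \<Lambda>"
  obtains f where "\<And>x. x \<in> \<Lambda> \<Longrightarrow> eval_ac f x = of_bool (galois_orbit x = galois_orbit \<mu>)"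
proof -
  define \<Lambda>' where "\<Lambda>' = {x \<in> \<Lambda>. galois_orbit x \<noteq> galois_orbit \<mu>}"
  \<comment> \<open>Since \<open>\<mu>\<close> lies outside the orbit of \<open>x\<close>, some
    polynomial relation of \<open>x\<close> fails at \<open>\<mu>\<close>.\<close>
  have "\<exists>f. eval_ac f x = 0 \<and> eval_ac f \<mu> \<noteq> 0" if "x \<in> \<Lambda>'" for x
    using that galois_orbit_eq_iff[of \<mu> x] by (auto simp: \<Lambda>'_def mem_galois_orbit_iff)
  then obtain p where p: "\<And>x. x \<in> \<Lambda>' \<Longrightarrow> eval_ac (p x) x = 0"
    "\<And>x. x \<in> \<Lambda>' \<Longrightarrow> eval_ac (p x) \<mu> \<noteq> 0" by metis
  define P where "P = (\<Prod>x\<in>\<Lambda>'. p x)"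
  have fin: "finite \<Lambda>'" using assms by (simp add: \<Lambda>'_def)
  have P0: "eval_ac P x = 0" if "x \<in> \<Lambda>'" for x
    using that fin p(1) by (auto simp: P_def eval_ac_prod prod_zero_iff)
  have "eval_ac P \<mu> \<noteq> 0"
    using fin p(2) by (auto simp: P_def eval_ac_prod prod_zero_iff)
  then obtain k where k: "eval_ac P \<mu> * eval_ac k (eval_ac P \<mu>) = 1"
    by (rule inverse_eval_ac)
  \<comment> \<open>The inverse of \<open>P(\<mu>)\<close> is \<open>k(P(\<mu>))\<close>, so
    composing \<open>k\<close> with \<open>P\<close> normalises while keeping the coefficients in
    \<open>K\<close>.\<close>
  define f where "f = P * pcompose k P"
  have "eval_ac f x = of_bool (galois_orbit x = galois_orbit \<mu>)" if "x \<in> \<Lambda>" for x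
  proof (cases "galois_orbit x = galois_orbit \<mu>")
    case True
    have "eval_ac (f - 1) \<mu> = 0"
      by (simp add: f_def k)
    moreover have "x \<in> galois_orbit \<mu>"
      using True by (simp add: galois_orbit_eq_iff)
    ultimately have "eval_ac (f - 1) x = 0"
      by (metis mem_galois_orbit_iff)
    with True show ?thesis by simp
  next
    case False
    with that P0[of x] show ?thesis by (simp add: f_def \<Lambda>'_def)
  qed
  with that show ?thesis by blast
qed

text \<open>Each point has exactly one orbit, so at most one term in the sum of the single-orbit
  indicators is non-zero there.\<close>

lemma orbits_indicator_polynomial:
  assumes "finite \<Lambda>" "T \<subseteq> galois_orbit ` \<Lambda>"
  obtains f where "\<And>x. x \<in> \<Lambda> \<Longrightarrow> eval_ac f x = of_bool (galois_orbit x \<in> T)"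
proof -
  have "\<exists>f. \<forall>x\<in>\<Lambda>. eval_ac f x = of_bool (galois_orbit x = C)" if "C \<in> T" for C
    using that assms orbit_indicator_polynomial[of \<Lambda>] by (metis imageE subsetD)
  then obtain e where e: "\<And>C x. C \<in> T \<Longrightarrow> x \<in> \<Lambda> \<Longrightarrow> eval_ac (e C) x = of_bool (galois_orbit x = C)"
    by metis
  have "finite T" using assms by (meson finite_imageI finite_subset)
  then have "eval_ac (\<Sum>C\<in>T. e C) x = of_bool (galois_orbit x \<in> T)" if "x \<in> \<Lambda>" for x
    using that by (simp add: eval_ac_sum e of_bool_def)
  with that show ?thesis by blast
qed

section \<open>Characters separate functions\<close>

lemma character_0: "\<psi> \<in> characters \<Longrightarrow> \<psi> 0 = 1"
  unfolding characters_def by (metis (mono_tags, lifting) add_0 mem_Collect_eq mult_cancel_right1)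

lemma character_add: "\<psi> \<in> characters \<Longrightarrow> \<psi> (g + h) = \<psi> g * \<psi> h"
  by (simp add: characters_def)

text \<open>Character values are roots of unity of order dividing \<open>CARD('g)\<close>, and a
  finite group has only finitely many functions into this finite set.\<close>

lemma finite_characters: "finite (characters :: ('g::{finite, ab_group_add} \<Rightarrow> 'l::field) set)"
proof -
  define Z where "Z = {z :: 'l. poly (monom 1 CARD('g) - 1) z = 0}"
  have "degree (monom 1 CARD('g) :: 'l poly) \<noteq> degree (1 :: 'l poly)"
    by (simp add: degree_monom_eq)
  then have "finite Z"
    unfolding Z_def by (intro poly_roots_finite) auto
  moreover have "\<psi> g \<in> Z" if "\<psi> \<in> characters" for \<psi> :: "'g \<Rightarrow> 'l" and g
  proof -
    \<comment> \<open>Translation by \<open>g\<close> permutes the group, so multiplying the product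
      of all values by \<open>\<psi> g ^ CARD('g)\<close> leaves it unchanged; being non-zero, it
      cancels.\<close>
    have "(\<Prod>h\<in>UNIV. \<psi> h) = (\<Prod>h\<in>UNIV. \<psi> (g + h))"
      by (rule prod.reindex_bij_witness[of _ "\<lambda>h. g + h" "\<lambda>h. h - g"]) auto
    also have "\<dots> = \<psi> g ^ CARD('g) * (\<Prod>h\<in>UNIV. \<psi> h)"
      by (simp add: character_add[OF that] prod.distrib)
    finally have "\<psi> g ^ CARD('g) = 1"
      using that by (simp add: characters_def)
    then show ?thesis by (simp add: Z_def poly_monom)
  qed
  ultimately show ?thesis
    by (intro finite_subset[OF _ finite_PiE[of UNIV "\<lambda>_. Z"]]) auto
qed

section \<open>Common eigenvectors of translations\<close>

definition translation_closed :: "('g::ab_group_add \<Rightarrow> 'l::field) set \<Rightarrow> bool" where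
  "translation_closed V \<longleftrightarrow> (\<forall>u\<in>V. \<forall>v\<in>V. (\<lambda>h. u h + v h) \<in> V) \<and>
     (\<forall>c. \<forall>v\<in>V. (\<lambda>h. c * v h) \<in> V) \<and> (\<forall>g. \<forall>v\<in>V. (\<lambda>h. v (h + g)) \<in> V)"

text \<open>The action of a polynomial in the translation by \<open>g\<close> on a function.\<close>

definition shift_act :: "'l::field poly \<Rightarrow> 'g::ab_group_add \<Rightarrow> ('g \<Rightarrow> 'l) \<Rightarrow> 'g \<Rightarrow> 'l" where
  "shift_act p g v h = (\<Sum>i\<le>degree p. coeff p i * v (h + ((+) g ^^ i) 0))"

lemma shift_act_altdef:
  assumes "degree p \<le> n"
  shows "shift_act p g v h = (\<Sum>i\<le>n. coeff p i * v (h + ((+) g ^^ i) 0))"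
  unfolding shift_act_def using assms
  by (intro sum.mono_neutral_left) (auto simp: coeff_eq_0)

lemma shift_act_diff: "shift_act (p - q) g v h = shift_act p g v h - shift_act q g v h"
proof -
  let ?n = "max (degree p) (degree q)"
  have "degree (p - q) \<le> ?n" by (simp add: degree_diff_le)
  then show ?thesis
    by (simp add: shift_act_altdef[of _ ?n] left_diff_distrib sum_subtractf)
qed

lemma shift_act_smult: "shift_act (smult c p) g v h = c * shift_act p g v h"
  by (simp add: shift_act_altdef[of _ "degree p"] sum_distrib_left mult.assoc)

text \<open>Multiplication by \<open>X\<close> acts as the translation by \<open>g\<close>, since
  \<open>((+) g ^^ i) 0\<close> is the \<open>i\<close>-fold multiple of \<open>g\<close>.\<close>

lemma shift_act_pCons: "shift_act (pCons a p) g v h = a * v h + shift_act p g v (h + g)"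
proof -
  have "shift_act (pCons a p) g v h
      = (\<Sum>i\<le>Suc (degree p). coeff (pCons a p) i * v (h + ((+) g ^^ i) 0))"
    by (rule shift_act_altdef) (simp add: degree_pCons_le)
  also have "\<dots> = a * v h + shift_act p g v (h + g)"
    unfolding sum.atMost_Suc_shift shift_act_def by (simp add: add.assoc)
  finally show ?thesis .
qed

lemma shift_act_monom: "shift_act (monom 1 n) g v h = v (h + ((+) g ^^ n) 0)"
  by (simp add: shift_act_altdef[of _ n] degree_monom_le if_distrib[of "\<lambda>c. c * _"] cong: if_cong)

lemma shift_act_mem:
  assumes "translation_closed V" "v \<in> V"
  shows "shift_act p g v \<in> V"
proof -
  have "(\<lambda>h. \<Sum>i\<le>n. coeff p i * v (h + ((+) g ^^ i) 0)) \<in> V" for n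
    by (induction n) (use assms in \<open>simp_all add: translation_closed_def\<close>)
  moreover have "shift_act p g v = (\<lambda>h. \<Sum>i\<le>degree p. coeff p i * v (h + ((+) g ^^ i) 0))"
    by (simp add: shift_act_def fun_eq_iff)
  ultimately show ?thesis by simp
qed

text \<open>If \<open>p = (X - z) q\<close> is a polynomial of least degree that annihilates \<open>v\<close>, then \<open>q\<close> maps
  \<open>v\<close> to an eigenvector.\<close>

lemma translation_eigenvector:
  fixes V :: "('g::{finite, ab_group_add} \<Rightarrow> 'l::alg_closed_field) set"
  assumes V: "translation_closed V" "v \<in> V" "v \<noteq> (\<lambda>_. 0)"
  obtains w z where "w \<in> V" "w \<noteq> (\<lambda>_. 0)" "\<And>h. w (h + g) = z * w h"
proof -
  \<comment> \<open>The multiples of \<open>g\<close> repeat in a finite group, so a difference of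
    two distinct monomials annihilates \<open>v\<close>.\<close>
  have "\<not> inj (\<lambda>i. ((+) g ^^ i) 0)"
    using finite_imageD[of "\<lambda>i. ((+) g ^^ i) 0" "UNIV :: nat set"] by auto
  then obtain i j where ij: "i \<noteq> j" "((+) g ^^ i) 0 = ((+) g ^^ j) 0"
    unfolding inj_on_def by blast
  define P where "P = (\<lambda>p. p \<noteq> 0 \<and> shift_act p g v = (\<lambda>_. 0))"
  have "monom 1 i \<noteq> (monom 1 j :: 'l poly)"
    using ij(1) by (metis degree_monom_eq one_neq_zero)
  then have "P (monom 1 i - monom 1 j)"
    using ij by (auto simp: P_def shift_act_diff shift_act_monom)
  from ex_has_least_nat[of P, OF this, of degree] obtain p
    where p: "P p" "\<And>q. P q \<Longrightarrow> degree p \<le> degree q" by blast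
  have "degree p \<noteq> 0"
  proof
    assume "degree p = 0"
    then obtain c where "p = [:c:]" by (auto elim: degree_eq_zeroE)
    with p(1) V(3) show False
      by (auto simp: P_def shift_act_def fun_eq_iff)
  qed
  then obtain z where "poly p z = 0"
    using alg_closed_imp_poly_has_root[of p] by auto
  then obtain q where q: "p = [:-z, 1:] * q"
    unfolding poly_eq_0_iff_dvd by auto
  with p(1) have "q \<noteq> 0" by (auto simp: P_def)
  then have "degree q < degree p"
    unfolding q by (subst degree_mult_eq) auto
  then have "\<not> P q"
    using p(2) not_less by blast
  with \<open>q \<noteq> 0\<close> have "shift_act q g v \<noteq> (\<lambda>_. 0)"
    by (simp add: P_def)
  moreover have "shift_act q g v (h + g) = z * shift_act q g v h" for h
  proof -
    have "p = pCons 0 q - smult z q" by (simp add: q)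
    then have "shift_act p g v h = shift_act q g v (h + g) - z * shift_act q g v h"
      by (simp add: shift_act_diff shift_act_smult shift_act_pCons)
    with p(1) show ?thesis by (simp add: P_def)
  qed
  ultimately show ?thesis
    using that shift_act_mem[OF V(1,2)] by blast
qed

text \<open>Translations commute, so a common eigenspace for the elements of \<open>F\<close> is
  translation-closed, and one more translation has an eigenvector inside it. Induction reaches the
  whole finite group.\<close>

lemma common_translation_eigenvector:
  fixes V :: "('g::{finite, ab_group_add} \<Rightarrow> 'l::alg_closed_field) set"
  assumes V: "translation_closed V" "v \<in> V" "v \<noteq> (\<lambda>_. 0)"
  obtains w \<psi> where "w \<in> V" "w \<noteq> (\<lambda>_. 0)" "\<And>g h. w (h + g) = \<psi> g * w h"
proof -
  have "\<exists>w\<in>V. w \<noteq> (\<lambda>_. 0) \<and> (\<exists>\<psi>. \<forall>g\<in>F. \<forall>h. w (h + g) = \<psi> g * w h)" if "finite F" for F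
    using that
  proof (induction F rule: finite_induct)
    case empty
    with V show ?case by auto
  next
    case (insert g F)
    then obtain w \<psi> where w: "w \<in> V" "w \<noteq> (\<lambda>_. 0)" "\<And>g h. g \<in> F \<Longrightarrow> w (h + g) = \<psi> g * w h"
      by blast
    define W where "W = {u \<in> V. \<forall>g\<in>F. \<forall>h. u (h + g) = \<psi> g * u h}"
    have "translation_closed W"
      unfolding translation_closed_def
    proof (intro conjI allI ballI)
      show "(\<lambda>h. u h + u' h) \<in> W" if "u \<in> W" "u' \<in> W" for u u'
        using that V(1) by (simp add: W_def translation_closed_def distrib_left)
      show "(\<lambda>h. c * u h) \<in> W" if "u \<in> W" for c u
        using that V(1) by (simp add: W_def translation_closed_def mult.left_commute)
      show "(\<lambda>h. u (h + k)) \<in> W" if "u \<in> W" for k u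
      proof -
        have "u (h + g' + k) = \<psi> g' * u (h + k)" if "g' \<in> F" for g' h
        proof -
          have eq: "h + g' + k = h + k + g'" by (simp add: add_ac)
          show ?thesis
            using \<open>u \<in> W\<close> \<open>g' \<in> F\<close> by (subst eq) (simp add: W_def)
        qed
        then show ?thesis
          using that V(1) by (simp add: W_def translation_closed_def)
      qed
    qed
    moreover have "w \<in> W" using w by (simp add: W_def)
    ultimately obtain u z where u: "u \<in> W" "u \<noteq> (\<lambda>_. 0)" "\<And>h. u (h + g) = z * u h"
      using translation_eigenvector[of W w g] w(2) by blast
    have "\<forall>g'\<in>insert g F. \<forall>h. u (h + g') = (\<psi>(g := z)) g' * u h"
      using u(1,3) insert.hyps by (auto simp: W_def)
    with u(1,2) show ?case unfolding W_def by blast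
  qed
  from this[of UNIV] that show ?thesis by auto
qed

text \<open>Otherwise the functions orthogonal to all characters contain a common eigenvector of the
  translations. It is a multiple of a character, hence not orthogonal to the inverse character.\<close>

lemma characters_separate:
  fixes v :: "'g::{finite, ab_group_add} \<Rightarrow> 'l::alg_closed_field"
  assumes N: "of_nat CARD('g) \<noteq> (0::'l)"
    and v: "\<And>\<psi>. \<psi> \<in> characters \<Longrightarrow> (\<Sum>h\<in>UNIV. v h * \<psi> h) = 0"
  shows "v = (\<lambda>_. 0)"
proof (rule ccontr)
  assume nz: "v \<noteq> (\<lambda>_. 0)"
  define V :: "('g \<Rightarrow> 'l) set" where "V = {v. \<forall>\<psi>\<in>characters. (\<Sum>h\<in>UNIV. v h * \<psi> h) = 0}"
  have "translation_closed V"
    unfolding translation_closed_def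
  proof (intro conjI allI ballI)
    show "(\<lambda>h. u h + w h) \<in> V" if "u \<in> V" "w \<in> V" for u w
      using that by (simp add: V_def distrib_right sum.distrib)
    show "(\<lambda>h. c * u h) \<in> V" if "u \<in> V" for c u
    proof -
      have "(\<Sum>h\<in>UNIV. c * u h * \<psi> h) = c * (\<Sum>h\<in>UNIV. u h * \<psi> h)" for \<psi>
        by (simp only: sum_distrib_left mult.assoc)
      with that show ?thesis by (simp add: V_def)
    qed
    show "(\<lambda>h. u (h + g)) \<in> V" if "u \<in> V" for g u
      unfolding V_def
    proof safe
      fix \<psi> :: "'g \<Rightarrow> 'l" assume \<psi>: "\<psi> \<in> characters"
      \<comment> \<open>Reindexing moves the translation onto the character, where it becomes the
        scalar \<open>\<psi> (- g)\<close>.\<close>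
      have "(\<Sum>h\<in>UNIV. u (h + g) * \<psi> h) = (\<Sum>h\<in>UNIV. u h * \<psi> (h + - g))"
        by (rule sum.reindex_bij_witness[of _ "\<lambda>h. h - g" "\<lambda>h. h + g"]) auto
      also have "\<dots> = (\<Sum>h\<in>UNIV. u h * \<psi> h) * \<psi> (- g)"
        by (simp only: character_add[OF \<psi>] sum_distrib_right mult.assoc)
      finally show "(\<Sum>h\<in>UNIV. u (h + g) * \<psi> h) = 0"
        using that \<psi> by (simp add: V_def)
    qed
  qed
  moreover have "v \<in> V" using v by (simp add: V_def)
  ultimately obtain w \<psi> where w: "w \<in> V" "w \<noteq> (\<lambda>_. 0)" "\<And>g h. w (h + g) = \<psi> g * w h"
    using nz common_translation_eigenvector[of V v] by blast
  \<comment> \<open>Thus \<open>w\<close> is \<open>w 0\<close> times \<open>\<psi>\<close>; once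
    \<open>w 0 \<noteq> 0\<close> is known, cancelling it yields the character laws for
    \<open>\<psi>\<close>.\<close>
  have w_eq: "w g = \<psi> g * w 0" for g
    using w(3)[of 0 g] by simp
  have w0: "w 0 \<noteq> 0"
  proof
    assume "w 0 = 0"
    then have "w g = 0" for g using w_eq[of g] by simp
    with w(2) show False by auto
  qed
  have mult: "\<psi> (g + h) = \<psi> g * \<psi> h" for g h
    using w(3)[of h g] w_eq[of h] w_eq[of "g + h"] w0
    by (metis add.commute mult.assoc mult_right_cancel)
  have "\<psi> 0 = 1"
    using w_eq[of 0] w0 by (metis mult_cancel_right1)
  then have nz_\<psi>: "\<psi> g \<noteq> 0" for g
    using mult[of g "- g"] by (metis mult_zero_left right_minus zero_neq_one)
  with mult nz_\<psi> have "(\<lambda>g. inverse (\<psi> g)) \<in> characters"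
    unfolding characters_def by simp
  with w(1) have "(\<Sum>h\<in>UNIV. w h * inverse (\<psi> h)) = 0"
    by (simp add: V_def)
  \<comment> \<open>The pairing with the inverse character is a sum of \<open>CARD('g)\<close>
    copies of \<open>w 0\<close>, which is non-zero by \<open>N\<close>.\<close>
  moreover have "w h * inverse (\<psi> h) = w 0" for h
    using w_eq[of h] nz_\<psi>[of h] by (metis mult.assoc mult.commute mult.right_neutral right_inverse)
  ultimately show False using N w0 by simp
qed

section \<open>The Fourier transform of a circulant matrix\<close>

text \<open>The entries depend only on the difference of the indices; phrased as invariance under
  simultaneous translation, this passes to products by reindexing the sum.\<close>

definition circulant :: "(('a, 'g::{finite, ab_group_add}) vec, 'g) vec \<Rightarrow> bool" where
  "circulant B \<longleftrightarrow> (\<forall>g h k. B $ (g + k) $ (h + k) = B $ g $ h)"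

text \<open>Row \<open>0\<close> determines a circulant matrix. For circulant \<open>B\<close> and a
  character \<open>\<psi>\<close>, this is the eigenvalue of \<open>B\<close> at the eigenvector
  \<open>\<psi>\<close>.\<close>

definition fourier :: "(('k::field, 'g) vec, 'g) vec \<Rightarrow> ('g::{finite, ab_group_add} \<Rightarrow> 'k alg_closure) \<Rightarrow> 'k alg_closure" where
  "fourier B \<psi> = (\<Sum>h\<in>UNIV. to_ac (B $ 0 $ h) * \<psi> h)"

lemma circulant_shift: "circulant B \<Longrightarrow> B $ g $ h = B $ 0 $ (h - g)"
  unfolding circulant_def by (metis add_0 diff_add_cancel)

lemma circulant_mult:
  assumes "circulant B" "circulant C"
  shows "circulant (B ** C)"
  unfolding circulant_def
proof (intro allI)
  fix g h k
  have "(\<Sum>i\<in>UNIV. B $ (g + k) $ i * C $ i $ (h + k))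
      = (\<Sum>i\<in>UNIV. B $ (g + k) $ (i + k) * C $ (i + k) $ (h + k))"
    by (rule sum.reindex_bij_witness[of _ "\<lambda>i. i + k" "\<lambda>i. i - k"]) auto
  also have "\<dots> = (\<Sum>i\<in>UNIV. B $ g $ i * C $ i $ h)"
    using assms by (simp add: circulant_def)
  finally show "(B ** C) $ (g + k) $ (h + k) = (B ** C) $ g $ h"
    by (simp add: matrix_matrix_mult_def)
qed

lemma circulant_mat_1: "circulant (mat 1)"
  by (simp add: circulant_def mat_def)

lemma circulant_matrix_pow: "circulant A \<Longrightarrow> circulant (matrix_pow A m)"
  by (induction m) (auto intro: circulant_mat_1 circulant_mult)

lemma circulant_poly_matrix: "circulant A \<Longrightarrow> circulant (poly_matrix f A)"
  using circulant_matrix_pow[of A] by (simp add: circulant_def poly_matrix_def)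

lemma circulant_cayley_adjacency: "circulant (cayley_adjacency S)"
  by (simp add: circulant_def cayley_adjacency_def)

text \<open>The identity \<open>row\<close> says that \<open>\<psi>\<close> is an eigenvector of
  \<open>C\<close> with eigenvalue \<open>fourier C \<psi>\<close>; applying row \<open>0\<close> of
  \<open>B\<close> to it yields the product.\<close>

lemma fourier_mult:
  assumes "circulant C" "\<psi> \<in> characters"
  shows "fourier (B ** C) \<psi> = fourier B \<psi> * fourier C \<psi>"
proof -
  have row: "(\<Sum>h\<in>UNIV. to_ac (C $ k $ h) * \<psi> h) = \<psi> k * fourier C \<psi>" for k
  proof -
    have "(\<Sum>h\<in>UNIV. to_ac (C $ k $ h) * \<psi> h) = (\<Sum>h\<in>UNIV. to_ac (C $ 0 $ h) * \<psi> (k + h))"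
      using circulant_shift[OF assms(1), of k]
      by (intro sum.reindex_bij_witness[of _ "\<lambda>h. k + h" "\<lambda>h. h - k"]) auto
    then show ?thesis
      by (simp add: character_add[OF assms(2)] fourier_def sum_distrib_left mult.left_commute)
  qed
  have "fourier (B ** C) \<psi> = (\<Sum>h\<in>UNIV. \<Sum>k\<in>UNIV. to_ac (B $ 0 $ k) * (to_ac (C $ k $ h) * \<psi> h))"
    by (simp add: fourier_def matrix_matrix_mult_def to_ac_sum sum_distrib_right mult.assoc)
  also have "\<dots> = (\<Sum>k\<in>UNIV. to_ac (B $ 0 $ k) * (\<Sum>h\<in>UNIV. to_ac (C $ k $ h) * \<psi> h))"
    by (subst sum.swap) (simp add: sum_distrib_left)
  also have "\<dots> = fourier B \<psi> * fourier C \<psi>"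
    by (simp only: row fourier_def[of B] sum_distrib_right mult.assoc)
  finally show ?thesis .
qed

lemma fourier_matrix_pow:
  assumes "circulant A" "\<psi> \<in> characters"
  shows "fourier (matrix_pow A m) \<psi> = fourier A \<psi> ^ m"
proof (induction m)
  case 0
  have "fourier (mat 1) \<psi> = (\<Sum>h\<in>UNIV. if h = 0 then \<psi> h else 0)"
    unfolding fourier_def by (intro sum.cong) (auto simp: mat_def)
  then show ?case
    by (simp add: character_0[OF assms(2)])
next
  case (Suc m)
  then show ?case
    by (simp add: fourier_mult circulant_matrix_pow assms)
qed

lemma fourier_poly_matrix:
  assumes "circulant A" "\<psi> \<in> characters"
  shows "fourier (poly_matrix f A) \<psi> = eval_ac f (fourier A \<psi>)"
proof -
  have "fourier (poly_matrix f A) \<psi>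
      = (\<Sum>h\<in>UNIV. \<Sum>m\<le>degree f. to_ac (coeff f m) * (to_ac (matrix_pow A m $ 0 $ h) * \<psi> h))"
    unfolding fourier_def poly_matrix_def
    by (simp only: vec_lambda_beta to_ac_sum to_ac_mult sum_distrib_right mult.assoc)
  also have "\<dots> = (\<Sum>m\<le>degree f. to_ac (coeff f m) * fourier (matrix_pow A m) \<psi>)"
    by (subst sum.swap) (simp only: fourier_def sum_distrib_left)
  finally show ?thesis
    by (simp only: fourier_matrix_pow[OF assms] eval_ac_altdef)
qed

text \<open>Row \<open>0\<close> of the adjacency matrix is the indicator function of
  \<open>S\<close>.\<close>

lemma fourier_cayley_adjacency: "fourier (cayley_adjacency S) \<psi> = char_eigenvalue S \<psi>"
proof -
  have "fourier (cayley_adjacency S) \<psi> = (\<Sum>h\<in>UNIV. if h \<in> S then \<psi> h else 0)"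
    unfolding fourier_def cayley_adjacency_def by (intro sum.cong) auto
  also have "\<dots> = (\<Sum>h | h \<in> S. \<psi> h)"
    using sum.inter_filter[of UNIV \<psi> "\<lambda>h. h \<in> S"] by simp
  finally show ?thesis
    by (simp add: char_eigenvalue_def)
qed

text \<open>The characteristic condition makes \<open>CARD('g)\<close> non-zero in \<open>L\<close>.
  The difference of the two rows at \<open>0\<close> is orthogonal to every character, hence zero,
  and these rows determine the matrices.\<close>

lemma fourier_inject:
  fixes B C :: "(('k::field, 'g::{finite, ab_group_add}) vec, 'g) vec"
  assumes "\<not> CHAR('k) dvd CARD('g)" "circulant B" "circulant C"
    and eq: "\<And>\<psi>. \<psi> \<in> characters \<Longrightarrow> fourier B \<psi> = fourier C \<psi>"
  shows "B = C"
proof -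
  have "(\<lambda>h. to_ac (B $ 0 $ h) - to_ac (C $ 0 $ h)) = (\<lambda>_. 0)"
  proof (rule characters_separate)
    show "of_nat CARD('g) \<noteq> (0 :: 'k alg_closure)"
      using assms(1) by (simp add: of_nat_eq_0_iff_char_dvd)
    show "(\<Sum>h\<in>UNIV. (to_ac (B $ 0 $ h) - to_ac (C $ 0 $ h)) * \<psi> h) = 0" if "\<psi> \<in> characters" for \<psi>
      using eq[OF that] by (simp add: fourier_def left_diff_distrib sum_subtractf)
  qed
  then have "B $ 0 $ h = C $ 0 $ h" for h
    by (auto dest: fun_cong[of _ _ h])
  then have "B $ g $ h = C $ g $ h" for g h
    using circulant_shift[OF assms(2)] circulant_shift[OF assms(3)] by metis
  then show ?thesis by (simp add: vec_eq_iff)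
qed

section \<open>Counting idempotents by sets of Galois orbits\<close>

theorem corollary7p2:
  fixes S :: "'g::{finite, ab_group_add} set"
  assumes "0 \<notin> S"
    and "uminus ` S = S"
    and "\<not> CHAR('k::field) dvd CARD('g)"
  shows "card {E \<in> (cayley_spectral_algebra S :: (('k, 'g) vec, 'g) vec set). E ** E = E} =
    2 ^ card (eigenvalue_orbits S :: 'k alg_closure set set)"
proof -
  define A :: "(('k, 'g) vec, 'g) vec" where "A = cayley_adjacency S"
  define \<Lambda> :: "'k alg_closure set" where "\<Lambda> = char_eigenvalue S ` characters"
  have circ: "circulant (poly_matrix f A)" for f
    by (simp add: A_def circulant_poly_matrix circulant_cayley_adjacency)
  have four: "fourier (poly_matrix f A) \<psi> = eval_ac f (char_eigenvalue S \<psi>)" if "\<psi> \<in> characters" for f \<psi>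
    using that
    by (simp add: A_def fourier_poly_matrix circulant_cayley_adjacency fourier_cayley_adjacency)
  \<comment> \<open>Both matrices are circulant, so equality can be tested on Fourier transforms,
    whose values are those of the polynomials on \<open>\<Lambda>\<close>.\<close>
  have matrix_eq_iff: "poly_matrix f A = poly_matrix g A \<longleftrightarrow> (\<forall>x\<in>\<Lambda>. eval_ac f x = eval_ac g x)" for f g
  proof
    assume eq: "poly_matrix f A = poly_matrix g A"
    have "eval_ac f (char_eigenvalue S \<psi>) = eval_ac g (char_eigenvalue S \<psi>)" if "\<psi> \<in> characters" for \<psi>
      using four[OF that, of f] four[OF that, of g] by (simp only: eq)
    then show "\<forall>x\<in>\<Lambda>. eval_ac f x = eval_ac g x" unfolding \<Lambda>_def by blast
  next
    assume "\<forall>x\<in>\<Lambda>. eval_ac f x = eval_ac g x"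
    then have "fourier (poly_matrix f A) \<psi> = fourier (poly_matrix g A) \<psi>" if "\<psi> \<in> characters" for \<psi>
      unfolding four[OF that] \<Lambda>_def using that by blast
    then show "poly_matrix f A = poly_matrix g A"
      by (rule fourier_inject[OF assms(3) circ circ])
  qed
  \<comment> \<open>After the Fourier transform, idempotency becomes \<open>y * y = y\<close> in a
    field for each value \<open>y\<close> of \<open>f\<close> on \<open>\<Lambda>\<close>.\<close>
  have idem_iff: "poly_matrix f A ** poly_matrix f A = poly_matrix f A \<longleftrightarrow>
      (\<forall>x\<in>\<Lambda>. eval_ac f x = 0 \<or> eval_ac f x = 1)" for f
  proof -
    have "poly_matrix f A ** poly_matrix f A = poly_matrix f A \<longleftrightarrow>
        (\<forall>\<psi>\<in>characters. fourier (poly_matrix f A ** poly_matrix f A) \<psi> = fourier (poly_matrix f A) \<psi>)"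
      by (rule iffI) (simp, rule fourier_inject[OF assms(3) circulant_mult[OF circ circ] circ], blast)
    also have "\<dots> \<longleftrightarrow> (\<forall>x\<in>\<Lambda>. eval_ac f x * eval_ac f x = eval_ac f x)"
      by (simp add: \<Lambda>_def fourier_mult[OF circ] four)
    finally show ?thesis by simp
  qed
  have fin: "finite \<Lambda>" by (simp add: \<Lambda>_def finite_characters)
  \<comment> \<open>An indicator polynomial \<open>F T\<close> is chosen for each set
    \<open>T\<close> of orbits; sending \<open>T\<close> to \<open>poly_matrix (F T) A\<close> is
    the bijection behind the count.\<close>
  have "\<forall>T\<in>Pow (galois_orbit ` \<Lambda>). \<exists>f. \<forall>x\<in>\<Lambda>. eval_ac f x = of_bool (galois_orbit x \<in> T)"
  proof
    fix T assume "T \<in> Pow (galois_orbit ` \<Lambda>)"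
    then have "T \<subseteq> galois_orbit ` \<Lambda>" by simp
    with fin obtain f where "\<And>x. x \<in> \<Lambda> \<Longrightarrow> eval_ac f x = of_bool (galois_orbit x \<in> T)"
      by (rule orbits_indicator_polynomial) blast
    then show "\<exists>f. \<forall>x\<in>\<Lambda>. eval_ac f x = of_bool (galois_orbit x \<in> T)" by blast
  qed
  from bchoice[OF this] obtain F where
    "\<forall>T\<in>Pow (galois_orbit ` \<Lambda>). \<forall>x\<in>\<Lambda>. eval_ac (F T) x = of_bool (galois_orbit x \<in> T)" ..
  then have F: "\<And>T x. T \<in> Pow (galois_orbit ` \<Lambda>) \<Longrightarrow> x \<in> \<Lambda> \<Longrightarrow>
      eval_ac (F T) x = of_bool (galois_orbit x \<in> T)" by blast
  have mem_iff: "E \<in> cayley_spectral_algebra S \<longleftrightarrow> (\<exists>f. E = poly_matrix f A)" for E :: "(('k, 'g) vec, 'g) vec"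
    by (simp add: cayley_spectral_algebra_def A_def)
  let ?I = "{E \<in> (cayley_spectral_algebra S :: (('k, 'g) vec, 'g) vec set). E ** E = E}"
  have inj: "inj_on (\<lambda>T. poly_matrix (F T) A) (Pow (galois_orbit ` \<Lambda>))"
  proof (rule inj_onI)
    fix T U assume TU: "T \<in> Pow (galois_orbit ` \<Lambda>)" "U \<in> Pow (galois_orbit ` \<Lambda>)"
      and "poly_matrix (F T) A = poly_matrix (F U) A"
    then have eq: "\<forall>x\<in>\<Lambda>. eval_ac (F T) x = eval_ac (F U) x"
      by (simp only: matrix_eq_iff)
    have "galois_orbit x \<in> T \<longleftrightarrow> galois_orbit x \<in> U" if "x \<in> \<Lambda>" for x
      using bspec[OF eq that] unfolding F[OF TU(1) that] F[OF TU(2) that]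
      by (auto simp: of_bool_def split: if_split_asm)
    with TU show "T = U" by blast
  qed
  have image: "(\<lambda>T. poly_matrix (F T) A) ` Pow (galois_orbit ` \<Lambda>) = ?I"
  proof (intro subset_antisym subsetI)
    fix E assume "E \<in> (\<lambda>T. poly_matrix (F T) A) ` Pow (galois_orbit ` \<Lambda>)"
    then obtain T where T: "E = poly_matrix (F T) A" "T \<in> Pow (galois_orbit ` \<Lambda>)"
      by (rule imageE)
    have "eval_ac (F T) x = 0 \<or> eval_ac (F T) x = 1" if "x \<in> \<Lambda>" for x
      unfolding F[OF T(2) that] by simp
    then have "E ** E = E" unfolding T(1) idem_iff by (rule ballI)
    moreover have "E \<in> cayley_spectral_algebra S"
      unfolding mem_iff by (rule exI, rule T(1))
    ultimately show "E \<in> ?I" by simp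
  next
    fix E assume "E \<in> ?I"
    then have E: "E \<in> cayley_spectral_algebra S" "E ** E = E" by simp_all
    from E(1) obtain f where f: "E = poly_matrix f A"
      unfolding mem_iff ..
    have f01: "eval_ac f x = 0 \<or> eval_ac f x = 1" if "x \<in> \<Lambda>" for x
      using E(2) that unfolding f idem_iff by (rule bspec)
    \<comment> \<open>These are the orbits on which \<open>f\<close> takes the value
      \<open>1\<close>; \<open>F T\<close> may differ from \<open>f\<close> as a polynomial but
      agrees with it on \<open>\<Lambda>\<close>.\<close>
    define T where "T = galois_orbit ` {x \<in> \<Lambda>. eval_ac f x = 1}"
    have T: "T \<in> Pow (galois_orbit ` \<Lambda>)" unfolding T_def by blast
    \<comment> \<open>The polynomial \<open>f - 1\<close> has coefficients in \<open>K\<close>, so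
      its zeros are closed under conjugation, and \<open>f\<close> cannot take both values
      \<open>0\<close> and \<open>1\<close> on one orbit.\<close>
    have const: "eval_ac f x = 1" if "galois_orbit x = galois_orbit y" "eval_ac f y = 1" for x y
    proof -
      have "eval_ac (f - 1) y = 0" using that(2) by simp
      moreover have "x \<in> galois_orbit y" using that(1) by (simp add: galois_orbit_eq_iff)
      ultimately have "eval_ac (f - 1) x = 0" unfolding mem_galois_orbit_iff by blast
      then show ?thesis by simp
    qed
    have "eval_ac f x = eval_ac (F T) x" if x: "x \<in> \<Lambda>" for x
    proof (cases "eval_ac f x = 1")
      case True
      with x have "galois_orbit x \<in> T" unfolding T_def by blast
      with True show ?thesis unfolding F[OF T x] by simp
    next
      case False
      then have "galois_orbit x \<notin> T" unfolding T_def using const by blast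
      with False f01[OF x] show ?thesis unfolding F[OF T x] by simp
    qed
    then have "E = poly_matrix (F T) A"
      unfolding f matrix_eq_iff by (rule ballI)
    with T show "E \<in> (\<lambda>T. poly_matrix (F T) A) ` Pow (galois_orbit ` \<Lambda>)"
      by (rule rev_image_eqI)
  qed
  have "card ?I = card (Pow (galois_orbit ` \<Lambda>))"
    unfolding image[symmetric] by (rule card_image[OF inj])
  also have "\<dots> = 2 ^ card (galois_orbit ` \<Lambda>)"
    by (intro card_Pow finite_imageI fin)
  finally show ?thesis
    unfolding eigenvalue_orbits_def \<Lambda>_def .
qed

end
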